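(* Let $u^1,\dots,u^J$ be an enumeration of the finite set $\{u\in\{0,1\}^{IT}: A_iu_i\leq b_i,\ i=1,\dots,I\}$. Then a solution $(q,u)$ is optimal to the unit commitment problem (UC) if and only if $$G_iq_i+H_iu_i\leq h_i,\quad A_iu_i\leq b_i,\quad u_i\in\{0,1\}^T,\quad i=1,\dots,I,$$ and there exist $q^j\in\mathbb{R}^{IT}$ and $\lambda_i^j\in\mathbb{R}^m$, $i=1,\dots,I$, $j=1,\dots,J$, such that $$\sum_{t=1}^TP_t(q_{t})-\sum_{i=1}^I\sum_{t=1}^TC_i(q_{it})-\sum_{i=1}^IS_i(u_i)\ \geq\ \sum_{t=1}^TP_t(q_{t}^{j})-\sum_{i=1}^I\sum_{t=1}^TC_i(q_{it}^j)-\sum_{i=1}^IS_i(u_i^j),\quad j=1,\dots,J,$$ and, for all $i=1,\dots,I$ and $j=1,\dots,J$, $$-\frac{\partial P_t}{\partial q_{it}}(q_t^j)+\frac{dC_i}{dq_{it}}(q_{it}^j)+(\lambda_{i}^j)^\top g_{it}=0,\ t=1,\dots,T,\qquad 0\leq \lambda_i^j\perp h_i-G_iq_i^j-H_iu_i^j\geq 0.$$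
   Context: Let $I,T,m,n$ be positive integers. Units are indexed by $i=1,\dots,I$ and time periods by $t=1,\dots,T$. Write $u=(u_{it})\in\mathbb{R}^{IT}$, $q=(q_{it})\in\mathbb{R}^{IT}$, with $u_i=(u_{i1},\dots,u_{iT})^\top$, $q_i=(q_{i1},\dots,q_{iT})^\top\in\mathbb{R}^T$ and $q_t=(q_{1t},\dots,q_{It})^\top\in\mathbb{R}^I$; similarly for $u^j,q^j$. For each $t$, $P_t:\mathbb{R}^I\to\mathbb{R}$ is concave and continuously differentiable. For each $i$, $C_i:\mathbb{R}\to\mathbb{R}$ is convex and continuously differentiable, $S_i:\mathbb{R}^T\to\mathbb{R}$ is continuous, $A_i\in\mathbb{R}^{n\times T}$, $b_i\in\mathbb{R}^n$, $G_i,H_i\in\mathbb{R}^{m\times T}$, $h_i\in\mathbb{R}^m$, and $g_{it}$ is the $t$-th column of $G_i$. The unit commitment problem (UC) is $$\max_{q,u}\Big\{\sum_{t=1}^TP_t(q_{t})-\sum_{i=1}^I\sum_{t=1}^TC_i(q_{it})-\sum_{i=1}^IS_i(u_i) : G_iq_i+H_iu_i\leq h_i,\ A_iu_i\leq b_i,\ u_i\in\{0,1\}^T,\ i=1,\dots,I\Big\},$$ and it is assumed to be feasible and bounded such that it has an optimal solution. The last group of conditions in the claim are the Karush-Kuhn-Tucker conditions for $q^j$ to be optimal for the economic dispatch problem obtained by fixing $u=u^j$, namely $\max_{q}\{\sum_{t}P_t(q_{t})-\sum_{i}\sum_{t}C_i(q_{it}): G_iq_i\leq h_i-H_iu_i^j,\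 i=1,\dots,I\}$. For vectors $x,y$, the notation $0\le x\perp y\ge 0$ means $x\ge 0$, $y\ge 0$ componentwise and $x^\top y=0$.
   Formalization: It is additionally assumed that for every enumerated u^j the economic dispatch problem with u=u^j has an optimal solution; otherwise "only if" fails, e.g. I=T=m=n=1, P=C=S=A=b=G=h=0, H=1, where u=1 admits no KKT point. *)

theory Defs
  imports "HOL-Analysis.Analysis"
begin

text \<open>
  Units are the elements of the finite type \<open>'i\<close>, time periods those of \<open>'t\<close>. A schedule
  \<open>q :: real^'t^'i\<close> (likewise \<open>u\<close>) has entries \<open>q $ i $ t\<close>: \<open>q $ i\<close> is the vector over time of
  unit \<open>i\<close> and \<open>column t q\<close> is the vector over units at time \<open>t\<close>. On \<open>real^'m\<close> the relation
  \<open>\<le>\<close> is the componentwise order.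
\<close>

definition cont_differentiable :: "('a::real_normed_vector \<Rightarrow> real) \<Rightarrow> bool" where
  "cont_differentiable f \<longleftrightarrow>
     (\<exists>D :: 'a \<Rightarrow> 'a \<Rightarrow>\<^sub>L real. (\<forall>x. (f has_derivative blinfun_apply (D x)) (at x))
        \<and> continuous_on UNIV D)"

definition partial_deriv :: "(real^'i \<Rightarrow> real) \<Rightarrow> 'i \<Rightarrow> real^'i \<Rightarrow> real" where
  "partial_deriv f i x = deriv (\<lambda>s. f (x + s *\<^sub>R axis i 1)) 0"

definition complementary :: "real^'m \<Rightarrow> real^'m \<Rightarrow> bool" where
  "complementary x y \<longleftrightarrow> 0 \<le> x \<and> 0 \<le> y \<and> x \<bullet> y = 0"

definition binary_vec :: "real^'t \<Rightarrow> bool" where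
  "binary_vec v \<longleftrightarrow> (\<forall>t. v $ t \<in> {0, 1})"

definition commitments :: "('i \<Rightarrow> real^'t^'n) \<Rightarrow> ('i \<Rightarrow> real^'n) \<Rightarrow> (real^'t^'i) set" where
  "commitments A b = {u. \<forall>i. binary_vec (u $ i) \<and> A i *v (u $ i) \<le> b i}"

definition dispatch_objective ::
  "('t \<Rightarrow> real^'i \<Rightarrow> real) \<Rightarrow> ('i \<Rightarrow> real \<Rightarrow> real) \<Rightarrow> real^'t^'i \<Rightarrow> real" where
  "dispatch_objective P C q =
     (\<Sum>t\<in>UNIV. P t (column t q)) - (\<Sum>i\<in>UNIV. \<Sum>t\<in>UNIV. C i (q $ i $ t))"

definition uc_objective ::
  "('t \<Rightarrow> real^'i \<Rightarrow> real) \<Rightarrow> ('i \<Rightarrow> real \<Rightarrow> real) \<Rightarrow> ('i \<Rightarrow> real^'t \<Rightarrow> real)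
    \<Rightarrow> real^'t^'i \<Rightarrow> real^'t^'i \<Rightarrow> real" where
  "uc_objective P C S q u = dispatch_objective P C q - (\<Sum>i\<in>UNIV. S i (u $ i))"

definition uc_feasible ::
  "('i \<Rightarrow> real^'t^'n) \<Rightarrow> ('i \<Rightarrow> real^'n)
    \<Rightarrow> ('i \<Rightarrow> real^'t^'m) \<Rightarrow> ('i \<Rightarrow> real^'t^'m) \<Rightarrow> ('i \<Rightarrow> real^'m)
    \<Rightarrow> real^'t^'i \<Rightarrow> real^'t^'i \<Rightarrow> bool" where
  "uc_feasible A b G H h q u \<longleftrightarrow>
     (\<forall>i. G i *v (q $ i) + H i *v (u $ i) \<le> h i \<and> A i *v (u $ i) \<le> b i \<and> binary_vec (u $ i))"

definition uc_optimal ::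
  "('t \<Rightarrow> real^'i \<Rightarrow> real) \<Rightarrow> ('i \<Rightarrow> real \<Rightarrow> real) \<Rightarrow> ('i \<Rightarrow> real^'t \<Rightarrow> real)
    \<Rightarrow> ('i \<Rightarrow> real^'t^'n) \<Rightarrow> ('i \<Rightarrow> real^'n)
    \<Rightarrow> ('i \<Rightarrow> real^'t^'m) \<Rightarrow> ('i \<Rightarrow> real^'t^'m) \<Rightarrow> ('i \<Rightarrow> real^'m)
    \<Rightarrow> real^'t^'i \<Rightarrow> real^'t^'i \<Rightarrow> bool" where
  "uc_optimal P C S A b G H h q u \<longleftrightarrow>
     is_arg_max (\<lambda>(q, u). uc_objective P C S q u) (\<lambda>(q, u). uc_feasible A b G H h q u) (q, u)"

text \<open>Economic dispatch: only \<open>q\<close> is decided, the commitment \<open>v\<close> is fixed.\<close>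

definition dispatch_optimal ::
  "('t \<Rightarrow> real^'i \<Rightarrow> real) \<Rightarrow> ('i \<Rightarrow> real \<Rightarrow> real)
    \<Rightarrow> ('i \<Rightarrow> real^'t^'m) \<Rightarrow> ('i \<Rightarrow> real^'t^'m) \<Rightarrow> ('i \<Rightarrow> real^'m)
    \<Rightarrow> real^'t^'i \<Rightarrow> real^'t^'i \<Rightarrow> bool" where
  "dispatch_optimal P C G H h v q \<longleftrightarrow>
     is_arg_max (dispatch_objective P C) (\<lambda>q. \<forall>i. G i *v (q $ i) \<le> h i - H i *v (v $ i)) q"

end

theory Submission
  imports Defs
begin

text \<open>
  For a fixed commitment the economic dispatch is a concave maximisation under linear
  constraints, so by Farkas' lemma the Karush-Kuhn-Tucker conditions characterise its maximisers
  without any constraint qualification. Hence a family \<open>q\<^sup>j\<close> satisfying these conditions attains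
  the best value for every commitment \<open>u\<^sup>j\<close>, and a feasible point is optimal for the unit
  commitment problem iff it is at least as good as all these finitely many values.
\<close>

section \<open>Farkas' lemma for finitely many generators\<close>

lemma farkas:
  fixes a :: "'k \<Rightarrow> 'v::euclidean_space"
  assumes fin: "finite K"
    and polar: "\<And>d. (\<And>k. k \<in> K \<Longrightarrow> a k \<bullet> d \<le> 0) \<Longrightarrow> c \<bullet> d \<le> 0"
  shows "\<exists>l. (\<forall>k\<in>K. 0 \<le> l k) \<and> c = (\<Sum>k\<in>K. l k *\<^sub>R a k)"
proof -
  let ?Z = "{\<Sum>k\<in>K. l k *\<^sub>R a k | l. \<forall>k\<in>K. (0::real) \<le> l k}"
  have "c \<in> convex_cone hull (a ` K)"
  proof (rule ccontr)
    assume "c \<notin> convex_cone hull (a ` K)"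
    then obtain e \<beta> where sep: "e \<bullet> c < \<beta>" "\<And>x. x \<in> convex_cone hull (a ` K) \<Longrightarrow> \<beta> < e \<bullet> x"
      using separating_hyperplane_closed_point[of "convex_cone hull (a ` K)" c]
      by (metis closed_convex_cone_hull convex_convex_cone_hull fin finite_imageI)
    have "\<beta> < 0"
      using sep(2)[OF convex_cone_hull_contains_0] by simp
    have "a k \<bullet> (- e) \<le> 0" if "k \<in> K" for k
    proof (rule ccontr)
      assume "\<not> a k \<bullet> (- e) \<le> 0"
      then have neg: "e \<bullet> a k < 0"
        by (simp add: inner_commute)
      \<comment> \<open>The factor is a quotient of two negative numbers, so the point stays in the
        cone, yet its inner product with \<open>e\<close> is exactly \<beta>, against the strict
        separation.\<close>
      have "(\<beta> / (e \<bullet> a k)) *\<^sub>R a k \<in> convex_cone hull (a ` K)"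
        using neg \<open>\<beta> < 0\<close> that
        by (intro convex_cone_hull_mul hull_inc) (auto simp: divide_nonpos_neg)
      from sep(2)[OF this] neg show False
        by simp
    qed
    then have "c \<bullet> (- e) \<le> 0"
      by (rule polar)
    with sep(1) \<open>\<beta> < 0\<close> show False
      by (simp add: inner_commute)
  qed
  moreover have "convex_cone hull (a ` K) \<subseteq> ?Z"
  proof (rule hull_minimal)
    show "a ` K \<subseteq> ?Z"
    proof
      fix x assume "x \<in> a ` K"
      then obtain j where j: "j \<in> K" "x = a j"
        by blast
      have "(\<Sum>k\<in>K. (if k = j then 1 else 0) *\<^sub>R a k) = (\<Sum>k\<in>K. if k = j then a k else 0)"
        by (rule sum.cong) auto
      also have "\<dots> = x"
        using j fin by simp
      finally show "x \<in> ?Z"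
        by (intro CollectI exI[of _ "\<lambda>k. if k = j then 1 else 0"]) simp
    qed
    show "convex_cone ?Z"
      unfolding convex_cone_iff
    proof (intro conjI ballI allI impI)
      show "0 \<in> ?Z"
        by (intro CollectI exI[of _ "\<lambda>_. 0"]) simp
    next
      fix x y assume "x \<in> ?Z" "y \<in> ?Z"
      then obtain l m where "\<forall>k\<in>K. 0 \<le> l k" "x = (\<Sum>k\<in>K. l k *\<^sub>R a k)"
        "\<forall>k\<in>K. 0 \<le> m k" "y = (\<Sum>k\<in>K. m k *\<^sub>R a k)"
        by blast
      then show "x + y \<in> ?Z"
        by (intro CollectI exI[of _ "\<lambda>k. l k + m k"]) (simp add: scaleR_left_distrib sum.distrib)
    next
      fix x and s :: real assume "x \<in> ?Z" "0 \<le> s"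
      then obtain l where "\<forall>k\<in>K. 0 \<le> l k" "x = (\<Sum>k\<in>K. l k *\<^sub>R a k)"
        by blast
      then show "s *\<^sub>R x \<in> ?Z"
        using \<open>0 \<le> s\<close> by (intro CollectI exI[of _ "\<lambda>k. s * l k"]) (simp add: scaleR_sum_right)
    qed
  qed
  ultimately show ?thesis
    by blast
qed

section \<open>Derivatives along lines and concavity\<close>

text \<open>The chain rule on a line makes one-variable results available: the tangent bound, the
  test for increase to the right, and \<open>deriv\<close> as used in
  \<open>partial_deriv\<close>.\<close>

lemma has_derivative_along_line:
  assumes "(f has_derivative D) (at x)"
  shows "((\<lambda>s. f (x + s *\<^sub>R d)) has_real_derivative D d) (at 0)"
proof -
  have "((\<lambda>s. x + s *\<^sub>R d) has_derivative (\<lambda>s. s *\<^sub>R d)) (at 0)"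
    by (auto intro!: derivative_eq_intros)
  then have "((\<lambda>s. f (x + s *\<^sub>R d)) has_derivative (\<lambda>s. D (s *\<^sub>R d))) (at 0)"
    by (rule has_derivative_compose) (use assms in simp)
  moreover have "D (s *\<^sub>R d) = D d * s" for s
    using linear_scale[OF has_derivative_linear[OF assms], of s d] by simp
  ultimately show ?thesis
    by (simp add: has_field_derivative_def)
qed

lemma concave_on_compose_linear:
  assumes "concave_on UNIV f" "linear L"
  shows "concave_on UNIV (\<lambda>x. f (L x))"
  using assms by (simp add: concave_on_iff linear_add linear_scale)

lemma concave_on_sum_functions:
  assumes "\<And>i. i \<in> I \<Longrightarrow> concave_on S (f i)" "convex S"
  shows "concave_on S (\<lambda>x. \<Sum>i\<in>I. f i x)"
  using assms
  by (induction I rule: infinite_finite_induct) (auto intro!: concave_on_add simp: concave_on_const)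

text \<open>On the line through \<open>x\<close> and \<open>y\<close>, \<open>- f\<close> is a
  convex function of one real variable; its tangent at parameter 0, evaluated at parameter 1, gives
  the bound.\<close>

lemma concave_on_below_tangent:
  assumes f: "concave_on UNIV f" and D: "(f has_derivative D) (at x)"
  shows "f y \<le> f x + D (y - x)"
proof -
  let ?\<phi> = "\<lambda>s. - f (x + s *\<^sub>R (y - x))"
  have "?\<phi> ((1 - t) *\<^sub>R s + t *\<^sub>R s') \<le> (1 - t) * ?\<phi> s + t * ?\<phi> s'"
    if "0 < t" "t < 1" for t s s' :: real
  proof -
    have "x + ((1 - t) *\<^sub>R s + t *\<^sub>R s') *\<^sub>R (y - x)
      = (1 - t) *\<^sub>R (x + s *\<^sub>R (y - x)) + t *\<^sub>R (x + s' *\<^sub>R (y - x))"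
      by (simp add: algebra_simps)
    then show ?thesis
      using concave_onD[OF f, of t "x + s *\<^sub>R (y - x)" "x + s' *\<^sub>R (y - x)"] that by simp
  qed
  then have "convex_on UNIV ?\<phi>"
    by (intro convex_onI) auto
  moreover have "(?\<phi> has_field_derivative - D (y - x)) (at 0)"
    by (intro DERIV_minus has_derivative_along_line D)
  ultimately have "?\<phi> 1 - ?\<phi> 0 \<ge> - D (y - x) * (1 - 0)"
    by (intro convex_on_imp_above_tangent[where A = UNIV]) auto
  then show ?thesis
    by simp
qed

section \<open>Optimality under finitely many linear constraints\<close>

text \<open>A direction that increases no active constraint can be followed a short way inside the
  polyhedron, so at a maximiser it is no ascent direction; this is the premise of
  \<open>farkas\<close>. Conversely, multipliers with complementary slackness make
  \<open>g \<bullet> (y - x)\<close> nonpositive for every feasible \<open>y\<close>, and concavity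
  keeps \<open>f y\<close> below the tangent.\<close>

lemma linear_kkt_iff:
  fixes a :: "'k \<Rightarrow> 'v::euclidean_space"
  assumes fin: "finite K" and concave: "concave_on UNIV f"
    and grad: "(f has_derivative (\<lambda>d. g \<bullet> d)) (at x)"
  shows "is_arg_max f (\<lambda>y. \<forall>k\<in>K. a k \<bullet> y \<le> r k) x \<longleftrightarrow>
    (\<forall>k\<in>K. a k \<bullet> x \<le> r k) \<and>
    (\<exists>l. (\<forall>k\<in>K. 0 \<le> l k \<and> l k * (r k - a k \<bullet> x) = 0) \<and> g = (\<Sum>k\<in>K. l k *\<^sub>R a k))"
    (is "?opt \<longleftrightarrow> ?feas \<and> ?kkt")
proof (intro iffI conjI; (elim conjE)?)
  assume opt: ?opt
  then show feas: ?feas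
    by (simp add: is_arg_max_def)
  let ?act = "{k \<in> K. a k \<bullet> x = r k}"
  have "g \<bullet> d \<le> 0" if d: "\<And>k. k \<in> ?act \<Longrightarrow> a k \<bullet> d \<le> 0" for d
  proof (rule ccontr)
    assume "\<not> g \<bullet> d \<le> 0"
    then obtain \<delta> where "\<delta> > 0" "\<forall>s>0. s < \<delta> \<longrightarrow> f x < f (x + s *\<^sub>R d)"
      using DERIV_pos_inc_right[OF has_derivative_along_line[OF grad, of d]] by auto
    then have "eventually (\<lambda>s. f x < f (x + s *\<^sub>R d)) (at_right 0)"
      by (auto simp: eventually_at_right_field)
    \<comment> \<open>Active constraints stay satisfied for every positive step by the choice of
      \<open>d\<close>; inactive ones have slack and survive small steps by continuity. Finiteness
      of \<open>K\<close> gives a common step size.\<close>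
    moreover have "eventually (\<lambda>s. \<forall>k\<in>K. a k \<bullet> (x + s *\<^sub>R d) \<le> r k) (at_right 0)"
    proof (intro eventually_ball_finite fin ballI)
      fix k assume k: "k \<in> K"
      show "eventually (\<lambda>s. a k \<bullet> (x + s *\<^sub>R d) \<le> r k) (at_right 0)"
      proof (cases "k \<in> ?act")
        case True
        have "a k \<bullet> (x + s *\<^sub>R d) \<le> r k" if "s > 0" for s
          using True d[OF True] mult_nonneg_nonpos[of s "a k \<bullet> d"] that by (simp add: inner_add_right)
        then show ?thesis
          by (auto simp: eventually_at_right_field intro: exI[of _ 1])
      next
        case False
        then have "a k \<bullet> x < r k"
          using feas k by fastforce
        moreover have "((\<lambda>s. a k \<bullet> (x + s *\<^sub>R d)) \<longlongrightarrow> a k \<bullet> (x + 0 *\<^sub>R d)) (at_right 0)"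
          by (intro tendsto_intros)
        ultimately have "eventually (\<lambda>s. a k \<bullet> (x + s *\<^sub>R d) < r k) (at_right 0)"
          by (auto dest: order_tendstoD(2))
        then show ?thesis
          by (rule eventually_mono) simp
      qed
    qed
    ultimately have "eventually (\<lambda>s. f x < f (x + s *\<^sub>R d)
        \<and> (\<forall>k\<in>K. a k \<bullet> (x + s *\<^sub>R d) \<le> r k)) (at_right (0::real))"
      by (rule eventually_conj)
    then obtain s where "f x < f (x + s *\<^sub>R d)" "\<forall>k\<in>K. a k \<bullet> (x + s *\<^sub>R d) \<le> r k"
      using eventually_happens trivial_limit_at_right_real by blast
    with opt show False
      by (auto simp: is_arg_max_def)
  qed
  then obtain l where l: "\<forall>k\<in>?act. 0 \<le> l k" "g = (\<Sum>k\<in>?act. l k *\<^sub>R a k)"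
    using farkas[of ?act a g] fin by auto
  \<comment> \<open>Inactive constraints receive multiplier 0, which is what complementary slackness
    demands of them.\<close>
  let ?l = "\<lambda>k. if k \<in> ?act then l k else 0"
  have "g = (\<Sum>k\<in>K. ?l k *\<^sub>R a k)"
    unfolding l(2) using fin by (intro sum.mono_neutral_cong_left) auto
  with l(1) show ?kkt
    by (intro exI[of _ ?l]) auto
next
  assume feas: ?feas and ?kkt
  then obtain l where l: "\<forall>k\<in>K. 0 \<le> l k \<and> l k * (r k - a k \<bullet> x) = 0"
    and g: "g = (\<Sum>k\<in>K. l k *\<^sub>R a k)"
    by blast
  have "f y \<le> f x" if y: "\<forall>k\<in>K. a k \<bullet> y \<le> r k" for y
  proof -
    have "l k * (a k \<bullet> (y - x)) \<le> 0" if "k \<in> K" for k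
    proof -
      \<comment> \<open>Inserting \<open>r k\<close> splits off a term that vanishes by
        complementary slackness; the other is nonpositive because \<open>y\<close> is
        feasible.\<close>
      have "l k * (a k \<bullet> (y - x)) = l k * (a k \<bullet> y - r k) + l k * (r k - a k \<bullet> x)"
        by (simp add: inner_diff_right algebra_simps)
      moreover have "l k * (a k \<bullet> y - r k) \<le> 0"
        using l y that by (intro mult_nonneg_nonpos) auto
      ultimately show ?thesis
        using l that by force
    qed
    then have "g \<bullet> (y - x) \<le> 0"
      by (simp add: g inner_sum_left sum_nonpos)
    with concave_on_below_tangent[OF concave grad, of y] show ?thesis
      by simp
  qed
  with feas show ?opt
    by (auto simp: is_arg_max_def not_less)
qed

section \<open>Concavity and gradient of the dispatch objective\<close>

lemma partial_deriv_eq: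
  assumes "(f has_derivative D) (at x)"
  shows "partial_deriv f i x = D (axis i 1)"
  unfolding partial_deriv_def by (intro DERIV_imp_deriv has_derivative_along_line assms)

text \<open>Expanding \<open>d\<close> in the standard basis expresses the total derivative through
  the partial derivatives that occur in the optimality conditions.\<close>

lemma has_derivative_eq_sum_partial_deriv:
  assumes "(f has_derivative D) (at x)"
  shows "D d = (\<Sum>i\<in>UNIV. partial_deriv f i x * d $ i)"
proof -
  have lin: "linear D"
    by (rule has_derivative_linear[OF assms])
  have "D d = D (\<Sum>i\<in>UNIV. d $ i *\<^sub>R axis i 1)"
    by (simp add: basis_expansion scalar_mult_eq_scaleR[symmetric])
  also have "\<dots> = (\<Sum>i\<in>UNIV. partial_deriv f i x * d $ i)"
    by (simp add: linear_sum[OF lin] linear_scale[OF lin] partial_deriv_eq[OF assms] mult.commute)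
  finally show ?thesis .
qed

lemma linear_column: "linear (column t)"
  by (auto simp: linear_iff column_def vec_eq_iff)

text \<open>Each summand is a concave function of a column or an entry of \<open>q\<close>, and both
  depend linearly on \<open>q\<close>.\<close>

lemma dispatch_objective_concave:
  fixes P :: "'t::finite \<Rightarrow> real^'i::finite \<Rightarrow> real"
  assumes "\<And>t. concave_on UNIV (P t)" and "\<And>i. convex_on UNIV (C i)"
  shows "concave_on UNIV (dispatch_objective P C)"
proof -
  have entry: "linear (\<lambda>q :: real^'t^'i. q $ i $ t)" for i t
    by (simp add: linear_iff)
  have C: "concave_on UNIV (\<lambda>s. - C i s)" for i
    using assms(2) by (simp add: concave_on_def)
  have "concave_on UNIV (\<lambda>q. (\<Sum>t\<in>UNIV. P t (column t q)) + (\<Sum>i\<in>UNIV. \<Sum>t\<in>UNIV. - C i (q $ i $ t)))"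
    by (intro concave_on_add concave_on_sum_functions convex_UNIV
        concave_on_compose_linear[OF assms(1) linear_column] concave_on_compose_linear[OF C entry])
  moreover have "dispatch_objective P C =
      (\<lambda>q. (\<Sum>t\<in>UNIV. P t (column t q)) + (\<Sum>i\<in>UNIV. \<Sum>t\<in>UNIV. - C i (q $ i $ t)))"
    by (simp add: fun_eq_iff dispatch_objective_def sum_negf)
  ultimately show ?thesis
    by simp
qed

text \<open>The space \<open>real^'t^'i\<close> carries the entrywise inner product, so the gradient
  is itself a schedule and \<open>linear_kkt_iff\<close> applies without flattening
  \<open>q\<close>.\<close>

lemma dispatch_objective_has_gradient:
  fixes P :: "'t::finite \<Rightarrow> real^'i::finite \<Rightarrow> real"
  assumes P: "\<And>t. P t differentiable at (column t q)"
    and C: "\<And>i t. C i differentiable at (q $ i $ t)"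
  shows "(dispatch_objective P C has_derivative
    (\<lambda>d. (\<chi> i t. partial_deriv (P t) i (column t q) - deriv (C i) (q $ i $ t)) \<bullet> d)) (at q)"
proof -
  obtain D where D: "\<And>t. (P t has_derivative D t) (at (column t q))"
    using P unfolding differentiable_def by metis
  have "(C i has_derivative (\<lambda>s. deriv (C i) (q $ i $ t) * s)) (at (q $ i $ t))" for i t
    using C[of i t] DERIV_deriv_iff_real_differentiable has_field_derivative_def by blast
  moreover have "((\<lambda>q. q $ i $ t) has_derivative (\<lambda>d. d $ i $ t)) (at q)" for i t
    by (intro bounded_linear_imp_has_derivative bounded_linear_compose[OF bounded_linear_vec_nth]
        bounded_linear_vec_nth)
  ultimately have C': "((\<lambda>q. C i (q $ i $ t)) has_derivative
      (\<lambda>d. deriv (C i) (q $ i $ t) * d $ i $ t)) (at q)" for i t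
    using has_derivative_compose[of "\<lambda>q. q $ i $ t"] by blast
  have "(column t has_derivative column t) (at q)" for t
    by (intro linear_imp_has_derivative linear_column)
  then have "((\<lambda>q. P t (column t q)) has_derivative (\<lambda>d. D t (column t d))) (at q)" for t
    using D has_derivative_compose by blast
  with C' have "(dispatch_objective P C has_derivative
      (\<lambda>d. (\<Sum>t\<in>UNIV. D t (column t d))
         - (\<Sum>i\<in>UNIV. \<Sum>t\<in>UNIV. deriv (C i) (q $ i $ t) * d $ i $ t))) (at q)"
    unfolding dispatch_objective_def[abs_def]
    by (intro has_derivative_diff has_derivative_sum) auto
  \<comment> \<open>The revenue term is summed over periods first; exchanging the sums matches the
    order of the inner product, which runs over units first.\<close>
  moreover have "(\<Sum>t\<in>UNIV. D t (column t d)) =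
      (\<Sum>i\<in>UNIV. \<Sum>t\<in>UNIV. partial_deriv (P t) i (column t q) * d $ i $ t)" for d
    by (subst sum.swap)
      (simp add: has_derivative_eq_sum_partial_deriv[OF D] column_def)
  ultimately show ?thesis
    by (simp add: inner_vec_def sum_subtractf left_diff_distrib)
qed

section \<open>Optimality conditions of the economic dispatch\<close>

text \<open>A sum of nonnegative products is zero only if each product is, so orthogonality becomes
  the componentwise slackness produced by \<open>linear_kkt_iff\<close>.\<close>

lemma complementary_iff:
  "complementary x y \<longleftrightarrow> (\<forall>k. 0 \<le> y $ k \<and> 0 \<le> x $ k \<and> x $ k * y $ k = 0)"
proof (cases "0 \<le> x \<and> 0 \<le> y")
  case True
  then have "x \<bullet> y = 0 \<longleftrightarrow> (\<forall>k. x $ k * y $ k = 0)"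
    by (simp add: inner_vec_def less_eq_vec_def sum_nonneg_eq_0_iff)
  with True show ?thesis
    by (auto simp: complementary_def less_eq_vec_def)
qed (auto simp: complementary_def less_eq_vec_def)

lemma dispatch_optimal_iff_kkt:
  fixes P :: "'t::finite \<Rightarrow> real^'i::finite \<Rightarrow> real"
    and G :: "'i \<Rightarrow> real^'t^'m::finite"
  assumes concave: "\<And>t. concave_on UNIV (P t)" "\<And>i. convex_on UNIV (C i)"
    and diff: "\<And>t. P t differentiable at (column t q)" "\<And>i t. C i differentiable at (q $ i $ t)"
  shows "dispatch_optimal P C G H h v q \<longleftrightarrow>
    (\<exists>l. \<forall>i. (\<forall>t. - partial_deriv (P t) i (column t q) + deriv (C i) (q $ i $ t)
                 + l i \<bullet> column t (G i) = 0) \<and>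
        complementary (l i) (h i - G i *v (q $ i) - H i *v (v $ i)))"
    (is "_ \<longleftrightarrow> ?kkt")
proof -
  \<comment> \<open>The vector constraints are flattened into scalar ones indexed by pairs: the
    normal for \<open>(i, k)\<close> is row \<open>k\<close> of \<open>G i\<close> placed in the
    block of unit \<open>i\<close>, with zeros for all other units.\<close>
  define a where "a = (\<lambda>(i, k). axis i (G i $ k) :: real^'t^'i)"
  define r where "r = (\<lambda>(i, k). h i $ k - (H i *v (v $ i)) $ k)"
  define g where "g = (\<chi> i t. partial_deriv (P t) i (column t q) - deriv (C i) (q $ i $ t))"
  have a: "a (i, k) \<bullet> y = (G i *v (y $ i)) $ k" for i k y
    by (simp add: a_def inner_axis' matrix_vector_mul_component)
  have feas: "(\<forall>k\<in>UNIV. a k \<bullet> y \<le> r k) \<longleftrightarrow> (\<forall>i. G i *v (y $ i) \<le> h i - H i *v (v $ i))" for y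
    by (simp add: a r_def less_eq_vec_def split_paired_All)
  \<comment> \<open>Only the normals of unit \<open>i\<close> reach entry \<open>(i, t)\<close>, and
    their entries there form column \<open>t\<close> of \<open>G i\<close>; this yields the
    multiplier term of the stationarity equation.\<close>
  have comb: "(\<Sum>k\<in>UNIV. l k *\<^sub>R a k) $ i $ t = (\<chi> k. l (i, k)) \<bullet> column t (G i)" for l i t
  proof -
    have "(\<Sum>k\<in>UNIV. l k *\<^sub>R a k) $ i $ t = (\<Sum>(j, k)\<in>UNIV. if j = i then l (j, k) * G j $ k $ t else 0)"
      by (auto simp: a_def axis_def intro!: sum.cong)
    also have "\<dots> = (\<Sum>j\<in>UNIV. \<Sum>k\<in>UNIV. if j = i then l (j, k) * G j $ k $ t else 0)"
      by (simp add: UNIV_Times_UNIV[symmetric] sum.cartesian_product del: UNIV_Times_UNIV)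
    also have "\<dots> = (\<Sum>j\<in>UNIV. if j = i then \<Sum>k\<in>UNIV. l (j, k) * G j $ k $ t else 0)"
      by (intro sum.cong) auto
    finally show ?thesis
      by (simp add: inner_vec_def column_def)
  qed
  have "(h i - G i *v (q $ i) - H i *v (v $ i)) $ k = r (i, k) - a (i, k) \<bullet> q" for i k
    by (simp add: a r_def)
  then have compl: "(\<forall>k. a k \<bullet> q \<le> r k \<and> 0 \<le> l k \<and> l k * (r k - a k \<bullet> q) = 0) \<longleftrightarrow>
      (\<forall>i. complementary (\<chi> k. l (i, k)) (h i - G i *v (q $ i) - H i *v (v $ i)))" for l
    by (simp add: complementary_iff split_paired_All del: vector_minus_component)
  have "dispatch_optimal P C G H h v q \<longleftrightarrow>
      (\<forall>k\<in>UNIV. a k \<bullet> q \<le> r k) \<and>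
      (\<exists>l. (\<forall>k\<in>UNIV. 0 \<le> l k \<and> l k * (r k - a k \<bullet> q) = 0) \<and> g = (\<Sum>k\<in>UNIV. l k *\<^sub>R a k))"
    unfolding dispatch_optimal_def feas[symmetric] g_def
    by (intro linear_kkt_iff dispatch_objective_concave dispatch_objective_has_gradient assms) simp
  \<comment> \<open>Primal feasibility does not involve \<open>l\<close>, so it moves under the
    quantifier and merges with the sign and slackness conditions into
    \<open>complementary\<close>.\<close>
  also have "\<dots> \<longleftrightarrow> (\<exists>l. (\<forall>k. a k \<bullet> q \<le> r k \<and> 0 \<le> l k \<and> l k * (r k - a k \<bullet> q) = 0)
      \<and> g = (\<Sum>k\<in>UNIV. l k *\<^sub>R a k))"
    by blast
  also have "\<dots> \<longleftrightarrow> (\<exists>l. (\<forall>i. complementary (\<chi> k. l (i, k)) (h i - G i *v (q $ i) - H i *v (v $ i)))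
      \<and> (\<forall>i t. g $ i $ t = (\<chi> k. l (i, k)) \<bullet> column t (G i)))"
    unfolding compl vec_eq_iff comb ..
  \<comment> \<open>Multipliers on pairs and families of vectors are the same data, by
    currying.\<close>
  also have "\<dots> \<longleftrightarrow> (\<exists>l. (\<forall>i. complementary (l i) (h i - G i *v (q $ i) - H i *v (v $ i)))
      \<and> (\<forall>i t. g $ i $ t = l i \<bullet> column t (G i)))"
    (is "(\<exists>l. ?Q (\<lambda>i. \<chi> k. l (i, k))) \<longleftrightarrow> (\<exists>l. ?Q l)")
  proof
    assume "\<exists>l. ?Q l"
    then obtain l where "?Q l"
      by blast
    then show "\<exists>l. ?Q (\<lambda>i. \<chi> k. l (i, k))"
      by (intro exI[of _ "\<lambda>(i, k). l i $ k"]) simp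
  qed (elim exE, rule exI)
  also have "\<dots> \<longleftrightarrow> ?kkt"
    by (rule ex_cong1) (auto simp: g_def algebra_simps)
  finally show ?thesis .
qed

section \<open>From economic dispatch to unit commitment\<close>

lemma uc_feasible_iff:
  "uc_feasible A b G H h q u \<longleftrightarrow>
    u \<in> commitments A b \<and> (\<forall>i. G i *v (q $ i) \<le> h i - H i *v (u $ i))"
  by (auto simp: uc_feasible_def commitments_def le_diff_eq)

text \<open>The term with \<open>S\<close> is constant once the commitment is fixed, so
  \<open>(Q v, v)\<close> is feasible and best among all feasible points with commitment
  \<open>v\<close>. Beating every feasible point is therefore the same as beating these
  representatives, whichever maximisers \<open>Q\<close> selects.\<close>

lemma uc_optimal_iff_dominates_dispatch:
  assumes opt: "\<And>v. v \<in> commitments A b \<Longrightarrow> dispatch_optimal P C G H h v (Q v)"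
  shows "uc_optimal P C S A b G H h q u \<longleftrightarrow> uc_feasible A b G H h q u \<and>
    (\<forall>v\<in>commitments A b. uc_objective P C S (Q v) v \<le> uc_objective P C S q u)"
proof -
  have "uc_feasible A b G H h (Q v) v" if "v \<in> commitments A b" for v
    using opt[OF that] that by (simp add: uc_feasible_iff dispatch_optimal_def is_arg_max_def)
  moreover have "uc_objective P C S q' v \<le> uc_objective P C S (Q v) v"
    if "uc_feasible A b G H h q' v" for q' v
  proof -
    have "dispatch_objective P C q' \<le> dispatch_objective P C (Q v)"
      using that opt[of v] by (auto simp: uc_feasible_iff dispatch_optimal_def is_arg_max_def not_less)
    then show ?thesis
      by (simp add: uc_objective_def)
  qed
  moreover have "v \<in> commitments A b" if "uc_feasible A b G H h q' v" for q' v
    using that by (simp add: uc_feasible_iff)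
  moreover have "uc_optimal P C S A b G H h q u \<longleftrightarrow> uc_feasible A b G H h q u \<and>
      (\<forall>q' v. uc_feasible A b G H h q' v \<longrightarrow> uc_objective P C S q' v \<le> uc_objective P C S q u)"
    by (auto simp: uc_optimal_def is_arg_max_def not_less)
  ultimately show ?thesis
    by (meson order_trans)
qed

theorem proposition1:
  fixes P :: "'t::finite \<Rightarrow> real^'i::finite \<Rightarrow> real"
    and C :: "'i \<Rightarrow> real \<Rightarrow> real"
    and S :: "'i \<Rightarrow> real^'t \<Rightarrow> real"
    and A :: "'i \<Rightarrow> real^'t^'n::finite"
    and b :: "'i \<Rightarrow> real^'n"
    and G H :: "'i \<Rightarrow> real^'t^'m::finite"
    and h :: "'i \<Rightarrow> real^'m"
    and J :: nat
    and us :: "nat \<Rightarrow> real^'t^'i"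
    and q u :: "real^'t^'i"
  assumes P_concave: "\<And>t. concave_on UNIV (P t)"
    and P_C1: "\<And>t. cont_differentiable (P t)"
    and C_convex: "\<And>i. convex_on UNIV (C i)"
    and C_C1: "\<And>i. C i C1_differentiable_on UNIV"
    and S_cont: "\<And>i. continuous_on UNIV (S i)"
    and uc_solvable: "\<exists>q' u'. uc_optimal P C S A b G H h q' u'"
    and dispatch_solvable: "\<And>v. v \<in> commitments A b \<Longrightarrow> \<exists>q'. dispatch_optimal P C G H h v q'"
    and enum: "bij_betw us {1..J} (commitments A b)"
  shows "uc_optimal P C S A b G H h q u \<longleftrightarrow>
    (\<forall>i. G i *v (q $ i) + H i *v (u $ i) \<le> h i \<and> A i *v (u $ i) \<le> b i \<and> binary_vec (u $ i)) \<and>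
    (\<exists>(qs :: nat \<Rightarrow> real^'t^'i) (lam :: nat \<Rightarrow> 'i \<Rightarrow> real^'m).
       (\<forall>j\<in>{1..J}. uc_objective P C S q u \<ge> uc_objective P C S (qs j) (us j)) \<and>
       (\<forall>i. \<forall>j\<in>{1..J}.
          (\<forall>t. - partial_deriv (P t) i (column t (qs j)) + deriv (C i) (qs j $ i $ t)
                 + lam j i \<bullet> column t (G i) = 0) \<and>
          complementary (lam j i) (h i - G i *v (qs j $ i) - H i *v (us j $ i))))"
proof -
  let ?com = "commitments A b"
  let ?kkt = "\<lambda>v x l. \<forall>i. (\<forall>t. - partial_deriv (P t) i (column t x) + deriv (C i) (x $ i $ t)
                 + l i \<bullet> column t (G i) = 0) \<and>
          complementary (l i) (h i - G i *v (x $ i) - H i *v (v $ i))"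
  \<comment> \<open>One dispatch problem involves all units at once, so the index \<open>j\<close>
    has to be fixed before \<open>i\<close>.\<close>
  have swap: "(\<forall>i. \<forall>j\<in>{1..J}. R i j) \<longleftrightarrow> (\<forall>j\<in>{1..J}. \<forall>i. R i j)" for R :: "'i \<Rightarrow> nat \<Rightarrow> bool"
    by blast
  have "P t differentiable at x" for t x
    using P_C1[of t] by (auto simp: cont_differentiable_def differentiable_def)
  moreover have "C i differentiable at s" for i s
    using C_C1[of i] by (simp add: C1_differentiable_on_eq)
  ultimately have kkt: "dispatch_optimal P C G H h v x \<longleftrightarrow> (\<exists>l. ?kkt v x l)" for v x
    by (intro dispatch_optimal_iff_kkt P_concave C_convex)
  have us: "us ` {1..J} = ?com"
    using enum by (rule bij_betw_imp_surj_on)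
  have "uc_optimal P C S A b G H h q u \<longleftrightarrow> uc_feasible A b G H h q u \<and>
      (\<exists>qs lam. (\<forall>j\<in>{1..J}. uc_objective P C S (qs j) (us j) \<le> uc_objective P C S q u) \<and>
         (\<forall>j\<in>{1..J}. ?kkt (us j) (qs j) (lam j)))"
    (is "_ \<longleftrightarrow> _ \<and> ?R")
  proof (intro iffI conjI; (elim conjE exE)?)
    assume opt: "uc_optimal P C S A b G H h q u"
    \<comment> \<open>The conditions must hold for every commitment, including suboptimal ones. They
      force the dispatch maximum to be attained, and \<open>dispatch_solvable\<close> supplies such
      a maximiser each time.\<close>
    obtain Q where Q: "\<And>v. v \<in> ?com \<Longrightarrow> dispatch_optimal P C G H h v (Q v)"
      using dispatch_solvable by metis
    show "uc_feasible A b G H h q u"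
      using opt by (simp add: uc_optimal_def is_arg_max_def)
    have dom: "\<forall>v\<in>?com. uc_objective P C S (Q v) v \<le> uc_objective P C S q u"
      using uc_optimal_iff_dominates_dispatch[THEN iffD1, OF Q opt] by blast
    obtain L where "\<And>v. v \<in> ?com \<Longrightarrow> ?kkt v (Q v) (L v)"
      using Q unfolding kkt by metis
    then show ?R
      using dom us by (intro exI[of _ "Q \<circ> us"] exI[of _ "L \<circ> us"]) auto
  next
    fix qs lam
    assume feas: "uc_feasible A b G H h q u"
      and dom: "\<forall>j\<in>{1..J}. uc_objective P C S (qs j) (us j) \<le> uc_objective P C S q u"
      and K: "\<forall>j\<in>{1..J}. ?kkt (us j) (qs j) (lam j)"
    \<comment> \<open>The given points are indexed by numbers, the comparison lemma by commitments;
      injectivity of \<open>us\<close> makes the translation recover exactly \<open>qs j\<close> at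
      \<open>us j\<close>.\<close>
    define Q where "Q = qs \<circ> inv_into {1..J} us"
    have Q: "Q (us j) = qs j" if "j \<in> {1..J}" for j
      using that enum by (simp add: Q_def bij_betw_inv_into_left)
    have opt: "dispatch_optimal P C G H h v (Q v)" if v: "v \<in> ?com" for v
    proof -
      obtain j where "j \<in> {1..J}" "v = us j"
        using v us by blast
      with K Q have "?kkt v (Q v) (lam j)"
        by simp
      then show ?thesis
        unfolding kkt by blast
    qed
    have "\<forall>v\<in>?com. uc_objective P C S (Q v) v \<le> uc_objective P C S q u"
      using dom Q unfolding us[symmetric] by simp
    with feas opt show "uc_optimal P C S A b G H h q u"
      by (intro iffD2[OF uc_optimal_iff_dominates_dispatch]) auto
  qed
  also have "uc_feasible A b G H h q u \<longleftrightarrow>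
      (\<forall>i. G i *v (q $ i) + H i *v (u $ i) \<le> h i \<and> A i *v (u $ i) \<le> b i \<and> binary_vec (u $ i))"
    by (simp add: uc_feasible_def)
  finally show ?thesis
    unfolding swap .
qed

end
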